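(* Let $\kappa_1,\kappa_2,\kappa_3,\kappa_4$ be arbitrary parameters, let $K$ be an algebraic closure of $\mathbb{C}(\kappa_1,\dots,\kappa_4)$, and consider the non-abelian system (with $z$ a central parameter) $$\frac{du}{dt}=P_1(u,v)+\kappa_4z,\qquad\frac{dv}{dt}=P_2(u,v)\qquad(\ast)$$ where, with $a_1,a_2,b_1,b_2,c_1\in K$, $$P_1=a_1u^2v+(2-a_1-a_2)uvu+a_2vu^2+\kappa_1u+\kappa_2u^2,$$ $$P_2=b_1uv^2-(2+b_1+b_2)vuv+b_2v^2u-\kappa_1v+c_1uv+(-2\kappa_2-c_1)vu-\kappa_3 .$$ Then $(\ast)$ has a non-abelian first integral of the form $$\begin{aligned}J=\;&d_1u^2v^2+d_2uv^2u+d_3uvuv+d_4vu^2v+d_5vuvu+\Big(1-\sum_{i=1}^5d_i\Big)v^2u^2+e_1uv+(\kappa_1-e_1)vu\\&+h_1u^2v+(\kappa_2-h_1-h_2)uvu+h_2vu^2+\kappa_3u+\kappa_4zv\end{aligned}$$ (for some $d_i,e_1,h_1,h_2\in K$) if and only if $(P_1,P_2)$ is one of the following eight pairs: (1) $P_1=2uvu+\kappa_1u+\kappa_2u^2$, $P_2=-2vuv-\kappa_1v-2\kappa_2vu-\kappa_3$; (2) $P_1=2uvu+\kappa_1u+\kappa_2u^2$, $P_2=-2vuv-\kappa_1v-2\kappa_2uv-\kappa_3$; (3) $P_1=2vu^2+\kappa_1u+\kappa_2u^2$, $P_2=-2v^2u-\kappa_1v-2\kappa_2vu-\kappa_3$;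 (4) $P_1=uvu+vu^2+\kappa_1u+\kappa_2u^2$, $P_2=-vuv-v^2u-\kappa_1v-\kappa_2uv-\kappa_2vu-\kappa_3$; (5) $P_1=uvu+vu^2+\kappa_1u+\kappa_2u^2$, $P_2=-vuv-v^2u-\kappa_1v-2\kappa_2vu-\kappa_3$; (6) $P_1=u^2v+uvu+\kappa_1u+\kappa_2u^2$, $P_2=-uv^2-vuv-\kappa_1v-\kappa_2uv-\kappa_2vu-\kappa_3$; (7) $P_1=u^2v+uvu+\kappa_1u+\kappa_2u^2$, $P_2=-uv^2-vuv-\kappa_1v-2\kappa_2uv-\kappa_3$; (8) $P_1=2u^2v+\kappa_1u+\kappa_2u^2$, $P_2=-2uv^2-\kappa_1v-2\kappa_2uv-\kappa_3$.
   Context: "Arbitrary parameters" means that $\kappa_1,\dots,\kappa_4$ are algebraically independent indeterminates over $\mathbb{C}$. The variables $u,v$ are generators of the free unital associative algebra $\mathcal{A}=K[z]\langle u,v\rangle$; $z$ is a central indeterminate (a parameter), and the coefficients of the system and of the integral do not depend on $z$. A system $du/dt=F_1,\ dv/dt=F_2$ with $F_1,F_2\in\mathcal{A}$ denotes the $K[z]$-linear derivation $d_t$ of $\mathcal{A}$ with $d_t(u)=F_1$, $d_t(v)=F_2$. An element $J\in\mathcal{A}$ is a non-abelian first integral if $d_t(J)=0$ in $\mathcal{A}$. (The system $(\ast)$ is the auxiliary autonomous system of the non-abelian Painlevé-$3'$ system $zu'=P_1+\kappa_4z$, $zv'=P_2$.) *)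

theory Defs
  imports Complex_Main "HOL-Computational_Algebra.Polynomial" "HOL-Library.Poly_Mapping"
begin

section \<open>Algebraic closures of fields of rational functions over the complex numbers\<close>

definition field_embedding :: "('a::field \<Rightarrow> 'k::field) \<Rightarrow> bool" where
  "field_embedding \<iota> \<longleftrightarrow>
     \<iota> 1 = 1 \<and> (\<forall>x y. \<iota> (x + y) = \<iota> x + \<iota> y) \<and> (\<forall>x y. \<iota> (x * y) = \<iota> x * \<iota> y)"

text \<open>
  A polynomial in \<open>length xs\<close> variables is given by a finite set \<open>M\<close> of exponent vectors and a
  coefficient function \<open>c\<close>.
\<close>
definition algebraically_independent :: "('a::field \<Rightarrow> 'k::field) \<Rightarrow> 'k list \<Rightarrow> bool" where
  "algebraically_independent \<iota> xs \<longleftrightarrow>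
     (\<forall>(M :: nat list set) c. finite M \<longrightarrow> (\<forall>m\<in>M. length m = length xs) \<longrightarrow>
        (\<Sum>m\<in>M. \<iota> (c m) * (\<Prod>i<length xs. xs ! i ^ (m ! i))) = 0 \<longrightarrow> (\<forall>m\<in>M. c m = 0))"

definition is_subfield :: "'k::field set \<Rightarrow> bool" where
  "is_subfield S \<longleftrightarrow> 0 \<in> S \<and> 1 \<in> S \<and> (\<forall>x\<in>S. \<forall>y\<in>S. x - y \<in> S \<and> x * y \<in> S) \<and> (\<forall>x\<in>S. inverse x \<in> S)"

definition generated_subfield :: "'k::field set \<Rightarrow> 'k set" where
  "generated_subfield A = \<Inter>{S. is_subfield S \<and> A \<subseteq> S}"

definition algebraic_over :: "'k::field set \<Rightarrow> 'k \<Rightarrow> bool" where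
  "algebraic_over F x \<longleftrightarrow> (\<exists>p. p \<noteq> 0 \<and> (\<forall>i. coeff p i \<in> F) \<and> poly p x = 0)"

text \<open>
  The type \<open>'k\<close>, with \<open>\<complex>\<close> embedded by \<open>\<iota>\<close>, is an algebraic closure of \<open>\<complex>(xs)\<close>, where the entries
  of \<open>xs\<close> are algebraically independent over \<open>\<complex>\<close>. That \<open>'k\<close> is algebraically closed is part of
  its type class.
\<close>
definition alg_closure_of_rational_functions ::
    "(complex \<Rightarrow> 'k::alg_closed_field) \<Rightarrow> 'k list \<Rightarrow> bool" where
  "alg_closure_of_rational_functions \<iota> xs \<longleftrightarrow>
     field_embedding \<iota> \<and> algebraically_independent \<iota> xs \<and>
     (\<forall>x. algebraic_over (generated_subfield (range \<iota> \<union> set xs)) x)"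

section \<open>The free algebra \<open>K[z]\<langle>u,v\<rangle>\<close>\<close>

text \<open>
  \<open>free_word\<close> is the free monoid on \<open>'x\<close>, written additively (\<open>0\<close> is the empty word, \<open>+\<close> is
  concatenation, not commutative), because the convolution product on \<open>\<Rightarrow>\<^sub>0\<close> is defined for
  additive monoids. The free algebra is its monoid ring over \<open>K[z]\<close>.
\<close>
datatype 'x free_word = Word "'x list"

instantiation free_word :: (type) monoid_add
begin

definition zero_free_word :: "'a free_word" where
  "zero_free_word = Word []"

fun plus_free_word :: "'a free_word \<Rightarrow> 'a free_word \<Rightarrow> 'a free_word" where
  "plus_free_word (Word xs) (Word ys) = Word (xs @ ys)"

instance
proof
  fix a b c :: "'a free_word"
  show "a + b + c = a + (b + c)" by (cases a; cases b; cases c) simp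
  show "0 + a = a" by (cases a) (simp add: zero_free_word_def)
  show "a + 0 = a" by (cases a) (simp add: zero_free_word_def)
qed

end

datatype letter = Letter_u | Letter_v

type_synonym 'k free_alg = "letter free_word \<Rightarrow>\<^sub>0 'k poly"

text \<open>\<open>coef\<close> is the central embedding of the coefficient ring \<open>K[z]\<close>.\<close>

definition coef :: "'k::field poly \<Rightarrow> 'k free_alg" where
  "coef c = Poly_Mapping.single 0 c"

abbreviation cst :: "'k::field \<Rightarrow> 'k free_alg" where
  "cst a \<equiv> coef [:a:]"

definition Z :: "'k::field free_alg" where "Z = coef [:0, 1:]"
definition U :: "'k::field free_alg" where "U = Poly_Mapping.single (Word [Letter_u]) 1"
definition V :: "'k::field free_alg" where "V = Poly_Mapping.single (Word [Letter_v]) 1"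

section \<open>Derivations and first integrals\<close>

definition is_derivation :: "('k::field free_alg \<Rightarrow> 'k free_alg) \<Rightarrow> bool" where
  "is_derivation d \<longleftrightarrow>
     (\<forall>x y. d (x + y) = d x + d y) \<and> (\<forall>c x. d (coef c * x) = coef c * d x) \<and>
     (\<forall>x y. d (x * y) = d x * y + x * d y)"

text \<open>
  The derivation \<open>d\<^sub>t\<close> of the system \<open>du/dt = F1\<close>, \<open>dv/dt = F2\<close>. The lemma
  \<open>ex1_system_derivation\<close> below shows that it is well defined for all \<open>F1\<close>, \<open>F2\<close>.
\<close>
definition system_derivation :: "'k::field free_alg \<Rightarrow> 'k free_alg \<Rightarrow> 'k free_alg \<Rightarrow> 'k free_alg" where
  "system_derivation F1 F2 = (THE d. is_derivation d \<and> d U = F1 \<and> d V = F2)"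

definition nonabelian_first_integral :: "'k::field free_alg \<Rightarrow> 'k free_alg \<Rightarrow> 'k free_alg \<Rightarrow> bool" where
  "nonabelian_first_integral F1 F2 J \<longleftrightarrow> system_derivation F1 F2 J = 0"

abbreviation monom_word :: "letter list \<Rightarrow> 'k::field free_alg" where
  "monom_word w \<equiv> Poly_Mapping.single (Word w) 1"

lemma monom_word_Nil: "monom_word [] = 1"
  by (simp flip: zero_free_word_def)

lemma monom_word_append: "monom_word (xs @ ys) = monom_word xs * monom_word ys"
  by (simp add: mult_single)

lemma monom_word_Cons: "monom_word (l # xs) = monom_word [l] * monom_word xs"
  using monom_word_append[of "[l]" xs] by simp

lemma coef_mult_monom_word: "coef c * monom_word w = Poly_Mapping.single (Word w) c"
  by (simp add: coef_def mult_single)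

lemma coef_add: "coef (a + b) = coef a + coef b"
  by (simp add: coef_def single_add)

lemma coef_mult: "coef (a * b) = coef a * coef b"
  by (simp add: coef_def mult_single)

lemma coef_0 [simp]: "coef 0 = 0"
  by (simp add: coef_def)

lemma coef_1 [simp]: "coef 1 = 1"
  by (simp add: coef_def)

lemma sum_single_lookup:
  "(\<Sum>k\<in>Poly_Mapping.keys x. Poly_Mapping.single k (Poly_Mapping.lookup x k)) = x"
  by (rule poly_mapping_eqI) (auto simp: lookup_sum lookup_single when_def in_keys_iff)

lemma free_alg_induct [case_names zero add]:
  assumes "P 0" and "\<And>c w x. P x \<Longrightarrow> P (coef c * monom_word w + x)"
  shows "P x"
proof -
  have "P (\<Sum>k\<in>A. Poly_Mapping.single k (Poly_Mapping.lookup x k))" if "finite A" for A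
    using that
  proof (induction A)
    case (insert k A)
    then show ?case
      using assms(2) by (cases k) (simp add: coef_mult_monom_word)
  qed (simp add: assms(1))
  from this[of "Poly_Mapping.keys x"] show ?thesis
    by (simp add: sum_single_lookup)
qed

lemma coef_central: "coef c * x = x * coef c"
proof (induction x rule: free_alg_induct)
  case (add b w x)
  then show ?case
    by (simp add: distrib_left distrib_right coef_mult_monom_word)
       (simp add: coef_def mult_single mult.commute)
qed simp

lemma coef_left_commute: "a * (coef c * x) = coef c * (a * x)"
proof -
  have "a * (coef c * x) = (a * coef c) * x"
    by (rule mult.assoc [symmetric])
  also have "\<dots> = (coef c * a) * x"
    by (rule arg_cong [where f = "\<lambda>t. t * x"], rule coef_central [symmetric])
  also have "\<dots> = coef c * (a * x)"
    by (rule mult.assoc)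
  finally show ?thesis .
qed

primrec der_word :: "'k::field free_alg \<Rightarrow> 'k free_alg \<Rightarrow> letter list \<Rightarrow> 'k free_alg" where
  "der_word F1 F2 [] = 0"
| "der_word F1 F2 (l # ls) =
     (case l of Letter_u \<Rightarrow> F1 | Letter_v \<Rightarrow> F2) * monom_word ls + monom_word [l] * der_word F1 F2 ls"

lemma der_word_append:
  "der_word F1 F2 (xs @ ys) = der_word F1 F2 xs * monom_word ys + monom_word xs * der_word F1 F2 ys"
proof (induction xs)
  case Nil
  then show ?case by (simp add: monom_word_Nil)
next
  case (Cons l xs)
  then show ?case
    by (simp add: monom_word_Cons[of l xs] monom_word_append distrib_left distrib_right mult.assoc)
qed

definition der_lin :: "'k::field free_alg \<Rightarrow> 'k free_alg \<Rightarrow> 'k free_alg \<Rightarrow> 'k free_alg" where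
  "der_lin F1 F2 x =
     (\<Sum>w | Word w \<in> Poly_Mapping.keys x. coef (Poly_Mapping.lookup x (Word w)) * der_word F1 F2 w)"

lemma finite_Word_vimage: "finite A \<Longrightarrow> finite {w. Word w \<in> A}"
  using finite_vimageI[of A Word] by (simp add: vimage_def inj_def)

lemma der_lin_superset:
  assumes "finite A" "{w. Word w \<in> Poly_Mapping.keys x} \<subseteq> A"
  shows "der_lin F1 F2 x = (\<Sum>w\<in>A. coef (Poly_Mapping.lookup x (Word w)) * der_word F1 F2 w)"
  unfolding der_lin_def using assms
  by (intro sum.mono_neutral_left) (auto simp: in_keys_iff)

lemma der_lin_add: "der_lin F1 F2 (x + y) = der_lin F1 F2 x + der_lin F1 F2 y"
proof -
  define A where "A = {w. Word w \<in> Poly_Mapping.keys x \<union> Poly_Mapping.keys y}"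
  have "finite A"
    unfolding A_def by (rule finite_Word_vimage) simp
  moreover have "{w. Word w \<in> Poly_Mapping.keys (x + y)} \<subseteq> A"
    using keys_add[of x y] by (auto simp: A_def)
  ultimately show ?thesis
    by (subst (1 2 3) der_lin_superset[of A])
       (auto simp: A_def lookup_add coef_add distrib_right sum.distrib)
qed

lemma der_lin_0: "der_lin F1 F2 0 = 0"
  by (simp add: der_lin_def)

lemma der_lin_monom: "der_lin F1 F2 (coef c * monom_word w) = coef c * der_word F1 F2 w"
  by (subst der_lin_superset[of "{w}"]) (auto simp: coef_mult_monom_word split: if_splits)

lemma der_lin_coef: "der_lin F1 F2 (coef c * x) = coef c * der_lin F1 F2 x"
proof (induction x rule: free_alg_induct)
  case (add b w x)
  have "coef c * (coef b * monom_word w + x) = coef (c * b) * monom_word w + coef c * x"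
    by (simp add: coef_mult distrib_left mult.assoc)
  moreover have "der_lin F1 F2 (coef (c * b) * monom_word w) = coef c * (coef b * der_word F1 F2 w)"
    using der_lin_monom[of F1 F2 "c * b" w] by (simp only: coef_mult mult.assoc)
  ultimately show ?case
    using add by (simp only: der_lin_add der_lin_monom distrib_left)
qed (simp add: der_lin_0)

lemma der_lin_mult: "der_lin F1 F2 (x * y) = der_lin F1 F2 x * y + x * der_lin F1 F2 y"
proof (induction x rule: free_alg_induct)
  case (add b w x)
  have "der_lin F1 F2 (monom_word w * y) = der_word F1 F2 w * y + monom_word w * der_lin F1 F2 y"
  proof (induction y rule: free_alg_induct)
    case (add c w' y)
    have "monom_word w * (coef c * monom_word w' + y)
        = coef c * monom_word (w @ w') + monom_word w * y"
      by (simp only: monom_word_append distrib_left coef_left_commute)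
    then have "der_lin F1 F2 (monom_word w * (coef c * monom_word w' + y))
        = coef c * (der_word F1 F2 w * monom_word w') + coef c * (monom_word w * der_word F1 F2 w')
          + (der_word F1 F2 w * y + monom_word w * der_lin F1 F2 y)"
      by (simp only: der_lin_add der_lin_monom der_word_append add distrib_left)
    also have "\<dots> = der_word F1 F2 w * (coef c * monom_word w' + y)
        + monom_word w * der_lin F1 F2 (coef c * monom_word w' + y)"
      by (simp only: der_lin_add der_lin_monom distrib_left coef_left_commute add_ac)
    finally show ?case .
  qed (simp add: der_lin_0)
  then have "der_lin F1 F2 (coef b * monom_word w * y)
      = coef b * (der_word F1 F2 w * y + monom_word w * der_lin F1 F2 y)"
    by (simp only: der_lin_coef mult.assoc)
  then show ?case
    by (simp only: distrib_right der_lin_add der_lin_monom add) (simp only: distrib_left mult.assoc add_ac)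
qed (simp add: der_lin_0)

lemma is_derivation_der_lin: "is_derivation (der_lin F1 F2)"
  unfolding is_derivation_def by (intro conjI allI der_lin_add der_lin_coef der_lin_mult)

lemma der_lin_U: "der_lin F1 F2 U = F1" and der_lin_V: "der_lin F1 F2 V = F2"
  using der_lin_monom[of F1 F2 1 "[Letter_u]"] der_lin_monom[of F1 F2 1 "[Letter_v]"]
  by (simp_all add: U_def V_def monom_word_Nil)

lemma derivation_unique:
  assumes d: "is_derivation d" and u: "d U = F1" and v: "d V = F2"
  shows "d = der_lin F1 F2"
proof
  fix x
  have lin: "d (x + y) = d x + d y" "d (coef c * x) = coef c * d x" "d (x * y) = d x * y + x * d y" for c x y
    using d by (auto simp: is_derivation_def)
  have d0: "d 0 = 0"
    using lin(2)[of 0 0] by simp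
  have d1: "d 1 = 0"
    using lin(3)[of 1 1] by simp
  have w: "d (monom_word w) = der_word F1 F2 w" for w
  proof (induction w)
    case (Cons l w)
    then show ?case
      using u v by (cases l) (simp_all add: monom_word_Cons[of _ w] lin(3) U_def V_def)
  qed (simp add: monom_word_Nil d1)
  show "d x = der_lin F1 F2 x"
    by (induction x rule: free_alg_induct)
       (simp_all add: d0 der_lin_0 lin(1,2) w der_lin_add der_lin_monom)
qed

lemma ex1_system_derivation: "\<exists>!d. is_derivation d \<and> d U = F1 \<and> d V = F2"
  proof (rule ex1I)
  show "is_derivation (der_lin F1 F2) \<and> der_lin F1 F2 U = F1 \<and> der_lin F1 F2 V = F2"
    by (intro conjI is_derivation_der_lin der_lin_U der_lin_V)
qed (blast intro: derivation_unique)

lemma system_derivation: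
  "is_derivation (system_derivation F1 F2)" "system_derivation F1 F2 U = F1" "system_derivation F1 F2 V = F2"
  using theI'[OF ex1_system_derivation, of F1 F2] unfolding system_derivation_def by auto

end

theory Submission
  imports Defs
begin

text \<open>
  Comparing coefficients of \<open>d\<^sub>t J\<close> word by word gives polynomial equations in the parameters.
  The words with two \<open>u\<close> and two \<open>v\<close> force \<open>b1 = -a1\<close> and \<open>b2 = -a2\<close>, since \<open>e1\<close> and \<open>\<kappa>1 - e1\<close> do
  not both vanish. The words \<open>uuuv\<close>, \<open>vuuu\<close> and \<open>z uv\<close> force \<open>(c1, h1, h2)\<close> to be one of
  \<open>(0, 0, \<kappa>2)\<close>, \<open>(-2\<kappa>2, \<kappa>2, 0)\<close>, \<open>(-\<kappa>2, 0, 0)\<close>. The words of length six, together with \<open>z uvv\<close> and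
  \<open>z vvu\<close>, leave five possibilities for \<open>(a1, a2)\<close>, and the words of length five exclude all but
  eight combinations with \<open>c1\<close>.
\<close>

section \<open>Derivations on explicit linear combinations of words\<close>

text \<open>Term lists are not normalised: words may repeat and coefficients may vanish. The product
  rule thus amounts to concatenating lists and can be evaluated by rewriting.\<close>

definition lin :: "('k::field poly \<times> letter list) list \<Rightarrow> 'k free_alg" where
  "lin ts = (\<Sum>(c, w)\<leftarrow>ts. coef c * monom_word w)"

definition coeff_at :: "('k::field poly \<times> letter list) list \<Rightarrow> letter list \<Rightarrow> 'k poly" where
  "coeff_at ts w = (\<Sum>(c, v)\<leftarrow>ts. if v = w then c else 0)"

primrec word_terms ::
    "('k::field poly \<times> letter list) list \<Rightarrow> ('k poly \<times> letter list) list \<Rightarrow>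
     letter list \<Rightarrow> ('k poly \<times> letter list) list" where
  "word_terms F1 F2 [] = []"
| "word_terms F1 F2 (l # ls) =
     map (\<lambda>(c, w). (c, w @ ls)) (case l of Letter_u \<Rightarrow> F1 | Letter_v \<Rightarrow> F2) @
     map (\<lambda>(c, w). (c, l # w)) (word_terms F1 F2 ls)"

definition der_terms ::
    "('k::field poly \<times> letter list) list \<Rightarrow> ('k poly \<times> letter list) list \<Rightarrow>
     ('k poly \<times> letter list) list \<Rightarrow> ('k poly \<times> letter list) list" where
  "der_terms F1 F2 J = concat (map (\<lambda>(c, w). map (\<lambda>(b, v). (c * b, v)) (word_terms F1 F2 w)) J)"

lemma lin_Nil [simp]: "lin [] = 0"
  by (simp add: lin_def)

lemma lin_Cons [simp]: "lin ((c, w) # ts) = coef c * monom_word w + lin ts"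
  by (simp add: lin_def)

lemma lin_append: "lin (xs @ ys) = lin xs + lin ys"
  by (simp add: lin_def)

lemma lin_mult_monom: "lin (map (\<lambda>(c, w). (c, w @ ls)) ts) = lin ts * monom_word ls"
proof (induction ts)
  case (Cons t ts)
  then show ?case
    by (cases t) (simp add: monom_word_append distrib_right mult.assoc)
qed simp

lemma monom_mult_lin: "lin (map (\<lambda>(c, w). (c, l # w)) ts) = monom_word [l] * lin ts"
proof (induction ts)
  case (Cons t ts)
  then show ?case
    by (cases t) (simp add: distrib_left coef_left_commute mult_single)
qed simp

lemma coef_mult_lin: "lin (map (\<lambda>(b, w). (c * b, w)) ts) = coef c * lin ts"
proof (induction ts)
  case (Cons t ts)
  then show ?case
    by (cases t) (simp only: list.map prod.case lin_Cons coef_mult distrib_left mult.assoc)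
qed simp

lemma der_word_lin: "der_word (lin F1) (lin F2) w = lin (word_terms F1 F2 w)"
proof (induction w)
  case (Cons l w)
  then show ?case
    by (cases l) (simp_all add: lin_append lin_mult_monom monom_mult_lin)
qed simp

lemma der_lin_lin: "der_lin (lin F1) (lin F2) (lin J) = lin (der_terms F1 F2 J)"
proof (induction J)
  case (Cons t J)
  then show ?case
    by (cases t) (simp only: der_terms_def list.map concat.simps prod.case lin_Cons der_lin_add
        der_lin_monom lin_append coef_mult_lin der_word_lin)
qed (simp add: der_terms_def der_lin_0)

section \<open>Coefficients of term lists\<close>

lemma lookup_lin: "Poly_Mapping.lookup (lin ts) (Word w) = coeff_at ts w"
proof (induction ts)
  case (Cons t ts)
  then show ?case
    by (cases t) (simp add: coeff_at_def coef_mult_monom_word lookup_add lookup_single when_def)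
qed (simp add: coeff_at_def)

lemma coeff_at_Nil: "coeff_at [] w = 0"
  and coeff_at_Cons_eq: "coeff_at ((c, w) # ts) w = c + coeff_at ts w"
  and coeff_at_Cons_neq: "v \<noteq> w \<Longrightarrow> coeff_at ((c, v) # ts) w = coeff_at ts w"
  by (simp_all add: coeff_at_def)

text \<open>Once all occurrences of a word have been collected into one equation, they are removed
  from the list, so that no word is examined twice.\<close>

definition drop_word ::
    "letter list \<Rightarrow> ('k::field poly \<times> letter list) list \<Rightarrow> ('k poly \<times> letter list) list" where
  "drop_word w = filter (\<lambda>(c, v). v \<noteq> w)"

lemma drop_word_simps:
  "drop_word w [] = []"
  "drop_word w ((c, w) # ts) = drop_word w ts"
  "v \<noteq> w \<Longrightarrow> drop_word w ((c, v) # ts) = (c, v) # drop_word w ts"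
  by (simp_all add: drop_word_def)

lemma coeff_at_drop_word: "coeff_at (drop_word w ts) v = (if v = w then 0 else coeff_at ts v)"
  by (induction ts) (auto simp: drop_word_def coeff_at_def)

lemma lin_eq_0_iff: "lin ts = 0 \<longleftrightarrow> (\<forall>w. coeff_at ts w = 0)"
proof
  assume *: "\<forall>w. coeff_at ts w = 0"
  show "lin ts = 0"
  proof (rule poly_mapping_eqI)
    fix x :: "letter free_word"
    show "Poly_Mapping.lookup (lin ts) x = Poly_Mapping.lookup 0 x"
      using * by (cases x) (simp add: lookup_lin)
  qed
qed (simp flip: lookup_lin)

text \<open>Distinct words are linearly independent over K[z]. As a rewrite rule this turns the
  vanishing of an explicit list into one equation per distinct word; the list gets shorter at each
  use.\<close>

lemma lin_Cons_eq_0_iff: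
  "lin ((c, w) # ts) = 0 \<longleftrightarrow> c + coeff_at ts w = 0 \<and> lin (drop_word w ts) = 0"
  unfolding lin_eq_0_iff coeff_at_drop_word
  by (metis coeff_at_Cons_eq coeff_at_Cons_neq)

lemma system_derivation_eq_der_lin: "system_derivation F1 F2 = der_lin F1 F2"
  by (intro derivation_unique system_derivation)

lemma first_integral_lin_iff:
  "nonabelian_first_integral (lin F1) (lin F2) (lin J) \<longleftrightarrow> lin (der_terms F1 F2 J) = 0"
  unfolding nonabelian_first_integral_def system_derivation_eq_der_lin der_lin_lin ..

lemma first_integral_lin_coeff_at:
  assumes "nonabelian_first_integral (lin F1) (lin F2) (lin J)"
  shows "coeff_at (der_terms F1 F2 J) w = 0"
  using assms by (simp add: first_integral_lin_iff lin_eq_0_iff)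

section \<open>The system and the integral as term lists\<close>

definition F1_terms :: "'k::field \<Rightarrow> 'k \<Rightarrow> 'k \<Rightarrow> 'k \<Rightarrow> 'k \<Rightarrow> ('k poly \<times> letter list) list" where
  "F1_terms \<kappa>1 \<kappa>2 \<kappa>4 a1 a2 =
     [([:a1:], [Letter_u, Letter_u, Letter_v]),
      ([:2 - a1 - a2:], [Letter_u, Letter_v, Letter_u]),
      ([:a2:], [Letter_v, Letter_u, Letter_u]),
      ([:\<kappa>1:], [Letter_u]),
      ([:\<kappa>2:], [Letter_u, Letter_u]),
      ([:0, \<kappa>4:], [])]"

definition F2_terms :: "'k::field \<Rightarrow> 'k \<Rightarrow> 'k \<Rightarrow> 'k \<Rightarrow> 'k \<Rightarrow> 'k \<Rightarrow> ('k poly \<times> letter list) list" where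
  "F2_terms \<kappa>1 \<kappa>2 \<kappa>3 b1 b2 c1 =
     [([:b1:], [Letter_u, Letter_v, Letter_v]),
      ([:- (2 + b1 + b2):], [Letter_v, Letter_u, Letter_v]),
      ([:b2:], [Letter_v, Letter_v, Letter_u]),
      ([:- \<kappa>1:], [Letter_v]),
      ([:c1:], [Letter_u, Letter_v]),
      ([:- 2 * \<kappa>2 - c1:], [Letter_v, Letter_u]),
      ([:- \<kappa>3:], [])]"

definition J_terms :: "'k::field \<Rightarrow> 'k \<Rightarrow> 'k \<Rightarrow> 'k \<Rightarrow> 'k \<Rightarrow> 'k \<Rightarrow> 'k \<Rightarrow> 'k \<Rightarrow> 'k \<Rightarrow> 'k \<Rightarrow> 'k \<Rightarrow> 'k \<Rightarrow> ('k poly \<times> letter list) list" where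
  "J_terms \<kappa>1 \<kappa>2 \<kappa>3 \<kappa>4 d1 d2 d3 d4 d5 e1 h1 h2 =
     [([:d1:], [Letter_u, Letter_u, Letter_v, Letter_v]),
      ([:d2:], [Letter_u, Letter_v, Letter_v, Letter_u]),
      ([:d3:], [Letter_u, Letter_v, Letter_u, Letter_v]),
      ([:d4:], [Letter_v, Letter_u, Letter_u, Letter_v]),
      ([:d5:], [Letter_v, Letter_u, Letter_v, Letter_u]),
      ([:1 - (d1 + d2 + d3 + d4 + d5):], [Letter_v, Letter_v, Letter_u, Letter_u]),
      ([:e1:], [Letter_u, Letter_v]),
      ([:\<kappa>1 - e1:], [Letter_v, Letter_u]),
      ([:h1:], [Letter_u, Letter_u, Letter_v]),
      ([:\<kappa>2 - h1 - h2:], [Letter_u, Letter_v, Letter_u]),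
      ([:h2:], [Letter_v, Letter_u, Letter_u]),
      ([:\<kappa>3:], [Letter_u]),
      ([:0, \<kappa>4:], [Letter_v])]"

lemma cst_1: "cst 1 = 1"
  by (simp flip: one_pCons)

lemma cst_uminus: "cst (- a) = - cst a"
  by (simp add: coef_def flip: single_uminus)

lemma cst_2: "cst 2 = 2"
  using coef_add[of "[:1:]" "[:1:]"] by (simp add: numeral_poly flip: one_pCons)

lemmas to_single = U_def V_def Z_def coef_def mult_single power2_eq_square zero_free_word_def
  add.assoc

lemma lin_F1_terms:
  "lin (F1_terms \<kappa>1 \<kappa>2 \<kappa>4 a1 a2) =
   cst a1 * U^2 * V + cst (2 - a1 - a2) * U * V * U + cst a2 * V * U^2
   + cst \<kappa>1 * U + cst \<kappa>2 * U^2 + cst \<kappa>4 * Z"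
  by (simp add: F1_terms_def to_single)

lemma lin_F2_terms:
  "lin (F2_terms \<kappa>1 \<kappa>2 \<kappa>3 b1 b2 c1) =
   cst b1 * U * V^2 - cst (2 + b1 + b2) * V * U * V + cst b2 * V^2 * U
   - cst \<kappa>1 * V + cst c1 * U * V + cst (- 2 * \<kappa>2 - c1) * V * U - cst \<kappa>3"
  \<comment> \<open>Term lists contain only sums, so the signs are first moved into the
    scalars.\<close>
  by (simp only: diff_conv_add_uminus flip: cst_uminus mult_minus_left)
    (simp add: F2_terms_def to_single)

lemma lin_J_terms:
  "lin (J_terms \<kappa>1 \<kappa>2 \<kappa>3 \<kappa>4 d1 d2 d3 d4 d5 e1 h1 h2) =
   cst d1 * U^2 * V^2 + cst d2 * U * V^2 * U + cst d3 * U * V * U * V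
   + cst d4 * V * U^2 * V + cst d5 * V * U * V * U
   + cst (1 - (d1 + d2 + d3 + d4 + d5)) * V^2 * U^2
   + cst e1 * U * V + cst (\<kappa>1 - e1) * V * U
   + cst h1 * U^2 * V + cst (\<kappa>2 - h1 - h2) * U * V * U + cst h2 * V * U^2
   + cst \<kappa>3 * U + cst \<kappa>4 * Z * V"
  by (simp add: J_terms_def to_single)

lemmas expand_der_terms = F1_terms_def F2_terms_def J_terms_def der_terms_def word_terms.simps
  list.map concat.simps append.simps prod.case letter.case

text \<open>Rules that decide equality of words and merely collect the polynomial coefficients;
  arithmetic is left to a second simplification.\<close>

lemmas compare_words = coeff_at_Nil coeff_at_Cons_eq coeff_at_Cons_neq drop_word_simps
  list.inject list.distinct letter.distinct simp_thms not_True_eq_False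


section \<open>Solving for the coefficients\<close>

text \<open>Genericity enters through the nonvanishing assumptions, which cancel factors: \<kappa>1
  in the balanced words of length four, \<kappa>4 in the equations carrying z, \<kappa>2 in the
  choice of \<open>c1\<close>, and 2 in the relation \<open>2 * (a1 * a2) = 0\<close>.\<close>

lemma parameters_of_first_integral:
  fixes \<kappa>1 \<kappa>2 \<kappa>3 \<kappa>4 :: "'k::field"
  assumes two: "(2::'k) \<noteq> 0" and \<kappa>: "\<kappa>1 \<noteq> 0" "\<kappa>2 \<noteq> 0" "\<kappa>4 \<noteq> 0"
    and int: "nonabelian_first_integral
      (lin (F1_terms \<kappa>1 \<kappa>2 \<kappa>4 a1 a2)) (lin (F2_terms \<kappa>1 \<kappa>2 \<kappa>3 b1 b2 c1))
      (lin (J_terms \<kappa>1 \<kappa>2 \<kappa>3 \<kappa>4 d1 d2 d3 d4 d5 e1 h1 h2))"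
  shows "b1 = - a1 \<and> b2 = - a2 \<and> (a1, a2, c1) \<in>
    {(0, 0, 0), (0, 0, - 2 * \<kappa>2), (0, 2, 0), (0, 1, - \<kappa>2), (0, 1, 0),
     (1, 0, - \<kappa>2), (1, 0, - 2 * \<kappa>2), (2, 0, - 2 * \<kappa>2)}"
proof -
  note coeff_eq_0 = first_integral_lin_coeff_at[OF int]
  \<comment> \<open>On words with as many u as v the linear terms \<kappa>1 u and -\<kappa>1 v
    cancel, so the quartic part of J drops out; what remains is the quadratic part of J met by the
    cubic part of the system.\<close>
  have uuvv: "e1 * (a1 + b1) = 0"
    using coeff_eq_0[of "[Letter_u, Letter_u, Letter_v, Letter_v]"]
    by (simp only: expand_der_terms compare_words) (simp add: algebra_simps)
  have uvuv: "e1 * (a1 + a2 + b1 + b2) = 0"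
    using coeff_eq_0[of "[Letter_u, Letter_v, Letter_u, Letter_v]"]
    by (simp only: expand_der_terms compare_words) (simp add: algebra_simps neg_eq_iff_add_eq_0)
  have vuvu: "(\<kappa>1 - e1) * (a1 + a2 + b1 + b2) = 0"
    using coeff_eq_0[of "[Letter_v, Letter_u, Letter_v, Letter_u]"]
    by (simp only: expand_der_terms compare_words) (simp add: algebra_simps)
  have vvuu: "(\<kappa>1 - e1) * (a2 + b2) = 0"
    using coeff_eq_0[of "[Letter_v, Letter_v, Letter_u, Letter_u]"]
    by (simp only: expand_der_terms compare_words) (simp add: algebra_simps)
  have s: "a1 + a2 + b1 + b2 = 0"
    using uvuv vuvu \<kappa>(1) by auto
  have "b1 = - a1 \<and> b2 = - a2"
  proof (cases "e1 = 0")
    case True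
    then have "a2 + b2 = 0"
      using vvuu \<kappa>(1) by simp
    then show ?thesis
      using s by (simp add: add_eq_0_iff add.assoc add.left_commute)
  next
    case False
    then have "a1 + b1 = 0"
      using uuvv by simp
    then show ?thesis
      using s by (simp add: add_eq_0_iff add.assoc add.left_commute)
  qed
  then have b: "b1 = - a1" "b2 = - a2"
    by auto
  note coeff_eq_0 = coeff_eq_0[unfolded b]
  have uuuv: "h1 * (c1 + 2 * \<kappa>2) = 0"
    using coeff_eq_0[of "[Letter_u, Letter_u, Letter_u, Letter_v]"]
    by (simp only: expand_der_terms compare_words) (simp add: algebra_simps)
  have vuuu: "c1 * h2 = 0"
    using coeff_eq_0[of "[Letter_v, Letter_u, Letter_u, Letter_u]"]
    by (simp only: expand_der_terms compare_words) (simp add: algebra_simps)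
  \<comment> \<open>This coefficient is a multiple of z: it comes from \<kappa>4 z in du/dt acting
    on the cubic part of J, and from the term \<kappa>4 z v of J.\<close>
  have zuv: "\<kappa>4 * (c1 + h1 - h2 + \<kappa>2) = 0"
    using coeff_eq_0[of "[Letter_u, Letter_v]"]
    by (simp only: expand_der_terms compare_words) (simp add: algebra_simps)
  have "c1 + h1 - h2 + \<kappa>2 = 0"
    using zuv \<kappa>(3) by simp
  then have c1: "c1 = h2 - h1 - \<kappa>2"
    by algebra
  have h: "c1 = 0 \<and> h1 = 0 \<and> h2 = \<kappa>2 \<or> c1 = - 2 * \<kappa>2 \<and> h1 = \<kappa>2 \<and> h2 = 0 \<or>
      c1 = - \<kappa>2 \<and> h1 = 0 \<and> h2 = 0"
  proof (cases "h1 = 0")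
    case True
    then show ?thesis
      using vuuu c1 by auto
  next
    case False
    then have "c1 = - 2 * \<kappa>2"
      using uuuv by (simp add: add_eq_0_iff2)
    moreover from this have "h2 = 0"
      using vuuu two \<kappa>(2) by simp
    ultimately show ?thesis
      using c1 by (simp add: algebra_simps)
  qed
  \<comment> \<open>The coefficient of v^2 u^2. Naming it shows the symmetry under reversal of
    words, which exchanges \<open>d1\<close> with \<open>d6\<close>, \<open>d3\<close> with
    \<open>d5\<close>, \<open>a1\<close> with \<open>a2\<close> and \<open>h1\<close> with
    \<open>h2\<close>.\<close>
  define d6 where "d6 = 1 - (d1 + d2 + d3 + d4 + d5)"
  note coeff_eq_0 = coeff_eq_0[unfolded J_terms_def, folded d6_def]
  have d1_a1: "d1 * (a1 - 2) = 0"
    using coeff_eq_0[of "[Letter_u, Letter_u, Letter_v, Letter_v, Letter_u, Letter_v]"]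
    by (simp only: expand_der_terms compare_words) (simp add: algebra_simps)
  have d1_a2: "d1 * a2 = 0"
    using coeff_eq_0[of "[Letter_u, Letter_u, Letter_v, Letter_v, Letter_v, Letter_u]"]
    by (simp only: expand_der_terms compare_words) (simp add: algebra_simps)
  have d1_c1: "d1 * (c1 + 2 * \<kappa>2) = 0"
    using coeff_eq_0[of "[Letter_u, Letter_u, Letter_u, Letter_v, Letter_v]"]
    by (simp only: expand_der_terms compare_words) (simp add: algebra_simps)
  have d6_a1: "d6 * a1 = 0"
    using coeff_eq_0[of "[Letter_v, Letter_v, Letter_u, Letter_u, Letter_u, Letter_v]"]
    by (simp only: expand_der_terms compare_words) (simp add: algebra_simps)
  have d6_a2: "d6 * (2 - a2) = 0"
    using coeff_eq_0[of "[Letter_v, Letter_v, Letter_u, Letter_u, Letter_v, Letter_u]"]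
    by (simp only: expand_der_terms compare_words) (simp add: algebra_simps)
  have d6_c1: "d6 * c1 = 0"
    using coeff_eq_0[of "[Letter_v, Letter_v, Letter_u, Letter_u, Letter_u]"]
    by (simp only: expand_der_terms compare_words) (simp add: algebra_simps)
  have uvv: "\<kappa>4 * (2 * d1 + d2 + d3 - a1) = 0"
    using coeff_eq_0[of "[Letter_u, Letter_v, Letter_v]"]
    by (simp only: expand_der_terms compare_words) (simp add: algebra_simps)
  have vvu: "\<kappa>4 * (2 * d6 + d2 + d5 - a2) = 0"
    using coeff_eq_0[of "[Letter_v, Letter_v, Letter_u]"]
    by (simp only: expand_der_terms compare_words) (simp add: algebra_simps)
  have uvuvvu: "a1 * d2 + a2 * d3 = 0"
    using coeff_eq_0[of "[Letter_u, Letter_v, Letter_u, Letter_v, Letter_v, Letter_u]"]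
    by (simp only: expand_der_terms compare_words) (simp add: algebra_simps neg_eq_iff_add_eq_0)
  have uvvuvu: "a2 * d2 + a1 * d5 = 0"
    using coeff_eq_0[of "[Letter_u, Letter_v, Letter_v, Letter_u, Letter_v, Letter_u]"]
    by (simp only: expand_der_terms compare_words) (simp add: algebra_simps neg_eq_iff_add_eq_0)
  have uvvuuv: "a1 * (d2 - d4) = 0"
    using coeff_eq_0[of "[Letter_u, Letter_v, Letter_v, Letter_u, Letter_u, Letter_v]"]
    by (simp only: expand_der_terms compare_words) (simp add: algebra_simps)
  have vuuvvu: "a2 * (d2 - d4) = 0"
    using coeff_eq_0[of "[Letter_v, Letter_u, Letter_u, Letter_v, Letter_v, Letter_u]"]
    by (simp only: expand_der_terms compare_words) (simp add: algebra_simps)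
  have uvuuv: "2 * h1 - 2 * a1 * h1 + a1 * (\<kappa>2 - h2) + c1 * d4 - d3 * \<kappa>2 = 0"
    using coeff_eq_0[of "[Letter_u, Letter_v, Letter_u, Letter_u, Letter_v]"]
    by (simp only: expand_der_terms compare_words) (simp add: algebra_simps)
  have vuuuv: "a1 * h2 + a2 * h1 = 0"
    using coeff_eq_0[of "[Letter_v, Letter_u, Letter_u, Letter_u, Letter_v]"]
    by (simp only: expand_der_terms compare_words) (simp add: algebra_simps)
  have "(a1, a2, c1) \<in>
    {(0, 0, 0), (0, 0, - 2 * \<kappa>2), (0, 2, 0), (0, 1, - \<kappa>2), (0, 1, 0),
     (1, 0, - \<kappa>2), (1, 0, - 2 * \<kappa>2), (2, 0, - 2 * \<kappa>2)}"
  proof (cases "d1 = 0 \<and> d6 = 0")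
    case False
    \<comment> \<open>\<open>d1\<close> nonzero forces the triple
      \<open>(2, 0, - 2 * \<kappa>2)\<close>, and \<open>d6\<close> nonzero forces
      \<open>(0, 2, 0)\<close>.\<close>
    then show ?thesis
      using d1_a1 d1_a2 d1_c1 d6_a1 d6_a2 d6_c1 by (auto simp: add_eq_0_iff2)
  next
    case True
    then have "d2 + d3 - a1 = 0" "d2 + d5 - a2 = 0"
      using uvv vvu \<kappa>(3) by simp_all
    then have a: "a1 = d2 + d3" "a2 = d2 + d5"
      by simp_all
    have d4: "d4 = 1 - d2 - d3 - d5"
      using True by (auto simp: d6_def algebra_simps)
    \<comment> \<open>The equations at uvuvvu and uvvuvu are added.\<close>
    have "2 * (a1 * a2) = (a1 * d2 + a2 * d3) + (a2 * d2 + a1 * d5)"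
      by (simp add: a algebra_simps)
    then have "a1 = 0 \<or> a2 = 0"
      using uvuvvu uvvuvu two by simp
    then consider "a1 = 0" "a2 = 0" | "a1 = 0" "a2 \<noteq> 0" | "a1 \<noteq> 0" "a2 = 0"
      by blast
    then show ?thesis
    proof cases
      case 1
      then have d: "d3 = - d2" "d4 = 1 + d2"
        using a d4 by (auto simp: add_eq_0_iff algebra_simps)
      have "c1 \<noteq> - \<kappa>2"
      proof
        assume c: "c1 = - \<kappa>2"
        then have "h1 = 0"
          using h c1 \<kappa>(2) by auto
        \<comment> \<open>The terms in \<open>d2\<close> cancel, and the equation at uvuuv reduces
          to -\<kappa>2 = 0.\<close>
        then show False
          using uvuuv 1 c d \<kappa>(2) by (simp add: algebra_simps)
      qed
      then show ?thesis
        using h 1 by blast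
    next
      case 2
      then have "d2 = 0" "d3 = 0" "d4 = 0"
        using uvuvvu vuuvvu a by auto
      then have "a2 = 1"
        using a d4 by simp
      moreover have "h1 = 0"
        using vuuuv 2 by simp
      \<comment> \<open>The third value of \<open>c1\<close> would require
        \<open>h1 = \<kappa>2\<close>.\<close>
      then have "c1 = 0 \<or> c1 = - \<kappa>2"
        using h \<kappa>(2) by blast
      ultimately show ?thesis
        using 2 by blast
    next
      \<comment> \<open>Mirror image of the preceding case under reversal of words.\<close>
      case 3
      then have "d2 = 0" "d5 = 0" "d4 = 0"
        using uvuvvu uvvuvu uvvuuv by auto
      then have "a1 = 1"
        using a d4 by simp
      moreover have "h2 = 0"
        using vuuuv 3 by simp
      then have "c1 = - 2 * \<kappa>2 \<or> c1 = - \<kappa>2"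
        using h \<kappa>(2) by blast
      ultimately show ?thesis
        using 3 by blast
    qed
  qed
  with b show ?thesis
    by blast
qed

section \<open>Explicit integrals for the eight systems\<close>

lemma first_integral_of_parameters:
  fixes \<kappa>1 \<kappa>2 \<kappa>3 \<kappa>4 :: "'k::field"
  assumes \<kappa>2: "\<kappa>2 \<noteq> 0" and
    "(a1, a2, c1) \<in>
      {(0, 0, 0), (0, 0, - 2 * \<kappa>2), (0, 2, 0), (0, 1, - \<kappa>2), (0, 1, 0),
       (1, 0, - \<kappa>2), (1, 0, - 2 * \<kappa>2), (2, 0, - 2 * \<kappa>2)}"
  shows "\<exists>d1 d2 d3 d4 d5 e1 h1 h2. nonabelian_first_integral
      (lin (F1_terms \<kappa>1 \<kappa>2 \<kappa>4 a1 a2)) (lin (F2_terms \<kappa>1 \<kappa>2 \<kappa>3 (- a1) (- a2) c1))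
      (lin (J_terms \<kappa>1 \<kappa>2 \<kappa>3 \<kappa>4 d1 d2 d3 d4 d5 e1 h1 h2))"
proof -
  \<comment> \<open>The witnesses solve the same equations; for \<open>a1 = a2 = 0\<close> only the words of length three
    determine \<open>e1\<close>, which is why \<open>\<kappa>2\<close> appears as a denominator.\<close>
  let ?int = "\<lambda>a1 a2 c1 d1 d3 d4 d5 e1 h1 h2. nonabelian_first_integral
      (lin (F1_terms \<kappa>1 \<kappa>2 \<kappa>4 a1 a2)) (lin (F2_terms \<kappa>1 \<kappa>2 \<kappa>3 (- a1) (- a2) c1))
      (lin (J_terms \<kappa>1 \<kappa>2 \<kappa>3 \<kappa>4 d1 0 d3 d4 d5 e1 h1 h2))"
  have "?int 0 0 0 0 0 1 0 (\<kappa>3 / \<kappa>2) 0 \<kappa>2"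
    using \<kappa>2
    by (simp only: first_integral_lin_iff expand_der_terms)
      (simp only: lin_Cons_eq_0_iff compare_words, simp add: algebra_simps)
  \<comment> \<open>Obtained from the preceding witness by reversing all words: \<open>c1\<close>
    becomes \<open>- 2 * \<kappa>2 - c1\<close>, \<open>e1\<close> becomes
    \<open>\<kappa>1 - e1\<close>, and \<open>h1\<close>, \<open>h2\<close> are exchanged.\<close>
  moreover have "?int 0 0 (- 2 * \<kappa>2) 0 0 1 0 (\<kappa>1 - \<kappa>3 / \<kappa>2) \<kappa>2 0"
    using \<kappa>2
    by (simp only: first_integral_lin_iff expand_der_terms)
      (simp only: lin_Cons_eq_0_iff compare_words, simp add: algebra_simps)
  \<comment> \<open>With \<open>d1\<close> to \<open>d5\<close> all zero, the quartic part is v^2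
    u^2.\<close>
  moreover have "?int 0 2 0 0 0 0 0 0 0 \<kappa>2"
    using \<kappa>2
    by (simp only: first_integral_lin_iff expand_der_terms)
      (simp only: lin_Cons_eq_0_iff compare_words, simp add: algebra_simps)
  moreover have "?int 0 1 (- \<kappa>2) 0 0 0 1 0 0 0"
    using \<kappa>2
    by (simp only: first_integral_lin_iff expand_der_terms)
      (simp only: lin_Cons_eq_0_iff compare_words, simp add: algebra_simps)
  moreover have "?int 0 1 0 0 0 0 1 0 0 \<kappa>2"
    using \<kappa>2
    by (simp only: first_integral_lin_iff expand_der_terms)
      (simp only: lin_Cons_eq_0_iff compare_words, simp add: algebra_simps)
  \<comment> \<open>This witness and the next two are the reversals of those for
    \<open>(0, 1, - \<kappa>2)\<close>, \<open>(0, 1, 0)\<close> and \<open>(0, 2, 0)\<close>, in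
    this order.\<close>
  moreover have "?int 1 0 (- \<kappa>2) 0 1 0 0 \<kappa>1 0 0"
    using \<kappa>2
    by (simp only: first_integral_lin_iff expand_der_terms)
      (simp only: lin_Cons_eq_0_iff compare_words, simp add: algebra_simps)
  moreover have "?int 1 0 (- 2 * \<kappa>2) 0 1 0 0 \<kappa>1 \<kappa>2 0"
    using \<kappa>2
    by (simp only: first_integral_lin_iff expand_der_terms)
      (simp only: lin_Cons_eq_0_iff compare_words, simp add: algebra_simps)
  moreover have "?int 2 0 (- 2 * \<kappa>2) 1 0 0 0 \<kappa>1 \<kappa>2 0"
    using \<kappa>2
    by (simp only: first_integral_lin_iff expand_der_terms)
      (simp only: lin_Cons_eq_0_iff compare_words, simp add: algebra_simps)
  ultimately show ?thesis
    using assms(2) unfolding insert_iff prod.inject empty_iff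
    by (elim disjE conjE FalseE; hypsubst; blast)
qed

section \<open>Nonvanishing of the parameters\<close>

lemma field_embedding_eq_0D:
  assumes "field_embedding \<iota>" and "\<iota> x = 0"
  shows "x = 0"
proof (rule ccontr)
  assume "x \<noteq> 0"
  have "\<iota> x * \<iota> (inverse x) = \<iota> (x * inverse x)"
    using assms(1) by (simp only: field_embedding_def)
  also have "\<dots> = 1"
    using assms(1) \<open>x \<noteq> 0\<close> by (simp add: field_embedding_def)
  finally have "\<iota> x * \<iota> (inverse x) = 1" .
  with assms(2) show False
    by simp
qed

lemma two_neq_0_of_field_embedding:
  fixes \<iota> :: "complex \<Rightarrow> 'k::field"
  assumes "field_embedding \<iota>"
  shows "(2::'k) \<noteq> 0"
proof -
  have "\<iota> (1 + 1) = 1 + 1"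
    using assms by (simp only: field_embedding_def)
  then show ?thesis
    using field_embedding_eq_0D[OF assms, of 2] by auto
qed

text \<open>A vanishing entry would satisfy a nontrivial relation consisting of one variable
  alone.\<close>

lemma algebraically_independent_neq_0:
  assumes "field_embedding \<iota>" "algebraically_independent \<iota> xs" "x \<in> set xs"
  shows "x \<noteq> 0"
proof
  assume "x = 0"
  then obtain j where j: "j < length xs" "xs ! j = 0"
    using assms(3) by (auto simp: in_set_conv_nth)
  \<comment> \<open>The exponent vector of the single variable at position \<open>j\<close>.\<close>
  define m where "m = map (\<lambda>i. if i = j then 1 else 0 :: nat) [0..<length xs]"
  have "(\<Prod>i<length xs. xs ! i ^ (m ! i)) = 0"
    using j by (auto simp: m_def intro!: bexI[of _ j])
  then have "(\<Sum>m\<in>{m}. \<iota> 1 * (\<Prod>i<length xs. xs ! i ^ (m ! i))) = 0"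
    by simp
  moreover have "length m = length xs"
    by (simp add: m_def)
  ultimately have "\<forall>m\<in>{m}. (\<lambda>_. 1) m = (0::'a)"
    using assms(2)[unfolded algebraically_independent_def, rule_format, of "{m}" "\<lambda>_. 1"]
    by simp
  then show False
    by simp
qed

section \<open>Classification of the systems\<close>

theorem proposition4:
  fixes \<iota> :: "complex \<Rightarrow> 'k::alg_closed_field"
    and \<kappa>1 \<kappa>2 \<kappa>3 \<kappa>4 a1 a2 b1 b2 c1 :: 'k
    and P1 P2 :: "'k free_alg"
  assumes "alg_closure_of_rational_functions \<iota> [\<kappa>1, \<kappa>2, \<kappa>3, \<kappa>4]"
    and "P1 = cst a1 * U^2 * V + cst (2 - a1 - a2) * U * V * U + cst a2 * V * U^2
               + cst \<kappa>1 * U + cst \<kappa>2 * U^2"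
    and "P2 = cst b1 * U * V^2 - cst (2 + b1 + b2) * V * U * V + cst b2 * V^2 * U
               - cst \<kappa>1 * V + cst c1 * U * V + cst (- 2 * \<kappa>2 - c1) * V * U - cst \<kappa>3"
  shows "(\<exists>d1 d2 d3 d4 d5 e1 h1 h2 :: 'k.
            nonabelian_first_integral (P1 + cst \<kappa>4 * Z) P2
              (cst d1 * U^2 * V^2 + cst d2 * U * V^2 * U + cst d3 * U * V * U * V
               + cst d4 * V * U^2 * V + cst d5 * V * U * V * U
               + cst (1 - (d1 + d2 + d3 + d4 + d5)) * V^2 * U^2
               + cst e1 * U * V + cst (\<kappa>1 - e1) * V * U
               + cst h1 * U^2 * V + cst (\<kappa>2 - h1 - h2) * U * V * U + cst h2 * V * U^2
               + cst \<kappa>3 * U + cst \<kappa>4 * Z * V))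
     \<longleftrightarrow>
     (P1, P2) \<in>
       {(2 * U * V * U + cst \<kappa>1 * U + cst \<kappa>2 * U^2,
         - 2 * V * U * V - cst \<kappa>1 * V - cst (2 * \<kappa>2) * V * U - cst \<kappa>3),
        (2 * U * V * U + cst \<kappa>1 * U + cst \<kappa>2 * U^2,
         - 2 * V * U * V - cst \<kappa>1 * V - cst (2 * \<kappa>2) * U * V - cst \<kappa>3),
        (2 * V * U^2 + cst \<kappa>1 * U + cst \<kappa>2 * U^2,
         - 2 * V^2 * U - cst \<kappa>1 * V - cst (2 * \<kappa>2) * V * U - cst \<kappa>3),
        (U * V * U + V * U^2 + cst \<kappa>1 * U + cst \<kappa>2 * U^2,
         - V * U * V - V^2 * U - cst \<kappa>1 * V - cst \<kappa>2 * U * V - cst \<kappa>2 * V * U - cst \<kappa>3),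
        (U * V * U + V * U^2 + cst \<kappa>1 * U + cst \<kappa>2 * U^2,
         - V * U * V - V^2 * U - cst \<kappa>1 * V - cst (2 * \<kappa>2) * V * U - cst \<kappa>3),
        (U^2 * V + U * V * U + cst \<kappa>1 * U + cst \<kappa>2 * U^2,
         - U * V^2 - V * U * V - cst \<kappa>1 * V - cst \<kappa>2 * U * V - cst \<kappa>2 * V * U - cst \<kappa>3),
        (U^2 * V + U * V * U + cst \<kappa>1 * U + cst \<kappa>2 * U^2,
         - U * V^2 - V * U * V - cst \<kappa>1 * V - cst (2 * \<kappa>2) * U * V - cst \<kappa>3),
        (2 * U^2 * V + cst \<kappa>1 * U + cst \<kappa>2 * U^2,
         - 2 * U * V^2 - cst \<kappa>1 * V - cst (2 * \<kappa>2) * U * V - cst \<kappa>3)}"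
proof -
  \<comment> \<open>The triples follow the order of the eight pairs in the statement, because the
    two sets are finally matched element by element.\<close>
  let ?params = "{(0, 0, 0), (0, 0, - 2 * \<kappa>2), (0, 2, 0), (0, 1, - \<kappa>2), (0, 1, 0),
    (1, 0, - \<kappa>2), (1, 0, - 2 * \<kappa>2), (2, 0, - 2 * \<kappa>2)}"
  \<comment> \<open>Setting \<kappa>4 to 0 gives P_1 without the term \<kappa>4 z, which is added
    back by \<open>F1\<close>.\<close>
  let ?sys = "\<lambda>(a1, a2, c1).
    (lin (F1_terms \<kappa>1 \<kappa>2 0 a1 a2), lin (F2_terms \<kappa>1 \<kappa>2 \<kappa>3 (- a1) (- a2) c1))"
  have closure: "field_embedding \<iota>" "algebraically_independent \<iota> [\<kappa>1, \<kappa>2, \<kappa>3, \<kappa>4]"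
    using assms(1) by (simp_all add: alg_closure_of_rational_functions_def)
  have two: "(2::'k) \<noteq> 0"
    by (rule two_neq_0_of_field_embedding[OF closure(1)])
  have \<kappa>: "\<kappa>1 \<noteq> 0" "\<kappa>2 \<noteq> 0" "\<kappa>4 \<noteq> 0"
    by (rule algebraically_independent_neq_0[OF closure]; simp)+
  have F1: "lin (F1_terms \<kappa>1 \<kappa>2 0 a1 a2) + cst \<kappa>4 * Z = lin (F1_terms \<kappa>1 \<kappa>2 \<kappa>4 a1 a2)" for a1 a2
    by (simp add: lin_F1_terms)
  have P1: "P1 = lin (F1_terms \<kappa>1 \<kappa>2 0 a1 a2)"
    by (simp add: assms(2) lin_F1_terms)
  have P2: "P2 = lin (F2_terms \<kappa>1 \<kappa>2 \<kappa>3 b1 b2 c1)"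
    by (simp only: assms(3) lin_F2_terms)
  have "(\<exists>d1 d2 d3 d4 d5 e1 h1 h2. nonabelian_first_integral (P1 + cst \<kappa>4 * Z) P2
      (lin (J_terms \<kappa>1 \<kappa>2 \<kappa>3 \<kappa>4 d1 d2 d3 d4 d5 e1 h1 h2))) \<longleftrightarrow> (P1, P2) \<in> ?sys ` ?params"
    (is "?int \<longleftrightarrow> _")
  proof
    assume ?int
    then have "b1 = - a1 \<and> b2 = - a2 \<and> (a1, a2, c1) \<in> ?params"
      unfolding P1 P2 F1 by (elim exE) (rule parameters_of_first_integral[OF two \<kappa>])
    then show "(P1, P2) \<in> ?sys ` ?params"
      by (intro image_eqI[of _ _ "(a1, a2, c1)"]) (simp_all only: P1 P2 prod.case)
  next
    assume "(P1, P2) \<in> ?sys ` ?params"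
    then obtain p where p: "p \<in> ?params" "(P1, P2) = ?sys p"
      by (rule imageE)
    obtain a1' a2' c1' where p_eq: "p = (a1', a2', c1')"
      by (cases p)
    \<comment> \<open>Equality of the pairs is enough: \<open>P1\<close> and \<open>P2\<close> are
      rewritten with the new parameters, with no need to identify these with \<open>a1\<close>,
      \<open>a2\<close>, \<open>c1\<close>.\<close>
    have P: "P1 = lin (F1_terms \<kappa>1 \<kappa>2 0 a1' a2')"
        "P2 = lin (F2_terms \<kappa>1 \<kappa>2 \<kappa>3 (- a1') (- a2') c1')"
      using p(2) unfolding p_eq prod.case prod.inject by blast+
    show ?int
      unfolding P F1 by (rule first_integral_of_parameters[OF \<kappa>(2) p(1)[unfolded p_eq]])
  qed
  then show ?thesis
    unfolding lin_J_terms
    by (rule trans)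
      (rule arg_cong[where f = "\<lambda>S. (P1, P2) \<in> S"],
       simp only: image_insert image_empty prod.case,
       intro arg_cong2[where f = insert] arg_cong2[where f = Pair] refl;
       simp add: lin_F1_terms lin_F2_terms cst_1 cst_2 cst_uminus)
qed

end
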